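(* Let $n\geq 2$ be an integer and let $J_{2n+1}$ be the flower snark graph. Then $$\gamma_{plsR}(J_{2n+1})\leq\begin{cases}5n+3, & \text{if } n \text{ is even},\\ 5n+4, & \text{if } n \text{ is odd.}\end{cases}$$
   Context: All graphs are finite, without loops or parallel edges. For $n\geq 2$, the flower snark graph $J_{2n+1}$ has vertex set $\{a_i,b_i,c_i,d_i : i\in\{0,1,\ldots,2n\}\}$ and edge set $\{a_ia_{i+1},\,c_ic_{i+1},\,d_id_{i+1} : i\in\{0,1,\ldots,2n-1\}\}\cup\{a_{2n}a_0\}\cup\{c_{2n}d_0,\,d_{2n}c_0\}\cup\{a_ib_i,\,b_ic_i,\,b_id_i : i\in\{0,1,\ldots,2n\}\}$. For a graph $G=(V,E)$ and $v\in V$, $N[v]=\{v\}\cup\{u : uv\in E\}$ is the closed neighborhood. A perfect locating signed Roman dominating (PLSRD) function on $G=(V,E)$ is a function $f: V\to\{-1,1,2\}$ such that: (C1) each vertex $v$ with $f(v)=-1$ is adjacent to exactly one vertex $u$ with $f(u)=2$; (C2) distinct vertices $v,w$ with $f(v)=f(w)=-1$ have no common neighbor $u$ with $f(u)=2$; (C3) for every vertex $v$, $\sum_{u\in N[v]} f(u)\geq 1$. The weight of $f$ is $f(V)=\sum_{v\in V} f(v)$. The perfect locating signed Roman domination number $\gamma_{plsR}(G)$ is the minimum weight over all PLSRD functions on $G$. *)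

theory Defs
  imports Main
begin

type_synonym 'v graph = "'v set \<times> 'v set set"

definition verts :: "'v graph \<Rightarrow> 'v set" where
  "verts G = fst G"

definition edges :: "'v graph \<Rightarrow> 'v set set" where
  "edges G = snd G"

definition fin_simple_graph :: "'v graph \<Rightarrow> bool" where
  "fin_simple_graph G \<longleftrightarrow> finite (verts G) \<and> (\<forall>e\<in>edges G. e \<subseteq> verts G \<and> card e = 2)"

definition adjacent :: "'v graph \<Rightarrow> 'v \<Rightarrow> 'v \<Rightarrow> bool" where
  "adjacent G u v \<longleftrightarrow> {u, v} \<in> edges G"

definition closed_nbhd :: "'v graph \<Rightarrow> 'v \<Rightarrow> 'v set" where
  "closed_nbhd G v = {v} \<union> {u. adjacent G u v}"

text \<open>Perfect locating signed Roman dominating functions. Values of \<open>f\<close> outside \<open>verts G\<close> are unconstrained; when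
  all edges lie inside \<open>verts G\<close>, neither the conditions below nor the weight depend on them.\<close>

definition PLSRD :: "'v graph \<Rightarrow> ('v \<Rightarrow> int) \<Rightarrow> bool" where
  "PLSRD G f \<longleftrightarrow>
     f ` verts G \<subseteq> {-1, 1, 2} \<and>
     (\<forall>v\<in>verts G. f v = -1 \<longrightarrow> (\<exists>!u. adjacent G u v \<and> f u = 2)) \<and>
     (\<forall>v\<in>verts G. \<forall>w\<in>verts G. v \<noteq> w \<and> f v = -1 \<and> f w = -1 \<longrightarrow>
        \<not> (\<exists>u. adjacent G u v \<and> adjacent G u w \<and> f u = 2)) \<and>
     (\<forall>v\<in>verts G. (\<Sum>u\<in>closed_nbhd G v. f u) \<ge> 1)"

definition weight :: "'v graph \<Rightarrow> ('v \<Rightarrow> int) \<Rightarrow> int" where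
  "weight G f = (\<Sum>v\<in>verts G. f v)"

definition plsR_number :: "'v graph \<Rightarrow> int" where
  "plsR_number G = Min {weight G f | f. PLSRD G f}"

text \<open>The minimum is attained: on a finite simple graph there are only finitely many weights, and
  the constant function 1 is a PLSRD function.\<close>

lemma finite_PLSRD_weights:
  assumes "fin_simple_graph G"
  shows "finite {weight G f | f. PLSRD G f}"
proof -
  let ?n = "int (card (verts G))"
  have "weight G f \<in> {- ?n..2 * ?n}" if "PLSRD G f" for f
  proof -
    have b: "-1 \<le> f v \<and> f v \<le> 2" if "v \<in> verts G" for v
      using \<open>PLSRD G f\<close> that unfolding PLSRD_def by fastforce
    show ?thesis
      using sum_bounded_below[of "verts G" "-1" f] sum_bounded_above[of "verts G" f 2] b
      by (simp add: weight_def mult.commute)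
  qed
  then have "{weight G f | f. PLSRD G f} \<subseteq> {- ?n..2 * ?n}"
    by blast
  then show ?thesis
    by (rule finite_subset) simp
qed

lemma PLSRD_const_1:
  assumes "fin_simple_graph G"
  shows "PLSRD G (\<lambda>_. 1)"
proof -
  have "card (closed_nbhd G v) \<ge> 1" if "v \<in> verts G" for v
  proof -
    have "closed_nbhd G v \<subseteq> verts G"
      using assms that by (auto simp: fin_simple_graph_def closed_nbhd_def adjacent_def)
    then have "finite (closed_nbhd G v)"
      using assms finite_subset by (auto simp: fin_simple_graph_def)
    moreover have "closed_nbhd G v \<noteq> {}"
      by (simp add: closed_nbhd_def)
    ultimately show ?thesis
      by (simp add: Suc_le_eq card_gt_0_iff)
  qed
  then show ?thesis
    by (force simp: PLSRD_def)
qed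

datatype snark_vertex = va nat | vb nat | vc nat | vd nat

text \<open>\<open>flower_snark n\<close> is the graph \<open>J\<close> with index \<open>2n+1\<close>, i.e. with \<open>2n+1\<close> stars
  \<open>{va i, vb i, vc i, vd i}\<close>.\<close>

definition flower_snark :: "nat \<Rightarrow> snark_vertex graph" where
  "flower_snark n =
    ((\<Union>i\<in>{0..2*n}. {va i, vb i, vc i, vd i}),
     (\<Union>i\<in>{0..<2*n}. {{va i, va (i+1)}, {vc i, vc (i+1)}, {vd i, vd (i+1)}}) \<union>
     {{va (2*n), va 0}} \<union>
     {{vc (2*n), vd 0}, {vd (2*n), vc 0}} \<union>
     (\<Union>i\<in>{0..2*n}. {{va i, vb i}, {vb i, vc i}, {vb i, vd i}}))"

lemma fin_simple_graph_flower_snark: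
  assumes "n \<ge> 1"
  shows "fin_simple_graph (flower_snark n)"
  using assms
  by (auto simp: fin_simple_graph_def flower_snark_def verts_def edges_def card_insert_if)

end

theory Submission
  imports Defs
begin

text \<open>Writing a labelling star by star as columns \<open>(f a\<^sub>i, f b\<^sub>i, f c\<^sub>i, f d\<^sub>i)\<close>, all PLSRD conditions
  are conditions on three consecutive columns; passing the end of the cycle of stars exchanges the
  last two entries of a column. A block of four columns of weight \<open>10\<close> can be repeated arbitrarily
  often, and it closes up across the exchange after a tail of one column of weight \<open>3\<close> (for \<open>n\<close>
  even) or three columns of total weight \<open>8\<close> (for \<open>n\<close> odd).\<close>

section \<open>Reduction of the PLSRD conditions to single neighbourhoods\<close>

lemma adjacent_commute: "adjacent G u v \<longleftrightarrow> adjacent G v u"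
  by (simp add: adjacent_def insert_commute)

lemma plsR_number_le_weight:
  assumes "fin_simple_graph G" and "PLSRD G f"
  shows "plsR_number G \<le> weight G f"
  unfolding plsR_number_def using assms by (intro Min_le finite_PLSRD_weights) auto

text \<open>The second conjunct is (C1) and the last is (C3), both seen from a vertex with value \<open>x\<close> whose
  neighbours have values \<open>ys\<close>; the third is (C2), seen from the common neighbour.\<close>

definition locally_PLSRD :: "int \<Rightarrow> int list \<Rightarrow> bool" where
  "locally_PLSRD x ys \<longleftrightarrow>
     x \<in> {-1, 1, 2} \<and>
     (x = -1 \<longrightarrow> length (filter (\<lambda>y. y = 2) ys) = 1) \<and>
     (x = 2 \<longrightarrow> length (filter (\<lambda>y. y = -1) ys) \<le> 1) \<and>
     x + sum_list ys \<ge> 1"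

lemma length_filter_eq_card:
  assumes "distinct us"
  shows "length (filter P us) = card {u \<in> set us. P u}"
  using assms by (metis distinct_card distinct_filter set_filter)

text \<open>With a duplicate-free list of the neighbours of each vertex, counting list entries is
  counting neighbours, so (C1)-(C3) become evaluations on short lists of values.\<close>

lemma PLSRD_if_locally_PLSRD:
  assumes G: "fin_simple_graph G"
    and nbrs: "\<And>v. v \<in> verts G \<Longrightarrow>
      \<exists>us. distinct us \<and> {u. adjacent G u v} = set us \<and> locally_PLSRD (f v) (map f us)"
  shows "PLSRD G f"
  unfolding PLSRD_def
proof (intro conjI ballI impI)
  show "f ` verts G \<subseteq> {-1, 1, 2}"
    using nbrs unfolding locally_PLSRD_def by blast
next
  fix v assume v: "v \<in> verts G" "f v = -1"
  then obtain us where us: "distinct us" "{u. adjacent G u v} = set us"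
    and "locally_PLSRD (f v) (map f us)"
    using nbrs by blast
  then have "card {u \<in> set us. f u = 2} = 1"
    using v by (simp add: locally_PLSRD_def filter_map o_def length_filter_eq_card)
  then obtain u where "{u \<in> set us. f u = 2} = {u}"
    by (auto simp: card_1_singleton_iff)
  with us(2) show "\<exists>!u. adjacent G u v \<and> f u = 2"
    by (intro ex1I[of _ u]) blast+
next
  fix v w assume vw: "v \<in> verts G" "w \<in> verts G" "v \<noteq> w \<and> f v = -1 \<and> f w = -1"
  show "\<not> (\<exists>u. adjacent G u v \<and> adjacent G u w \<and> f u = 2)"
  proof
    assume "\<exists>u. adjacent G u v \<and> adjacent G u w \<and> f u = 2"
    then obtain u where u: "adjacent G v u" "adjacent G w u" "f u = 2"
      by (auto simp: adjacent_commute)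
    \<comment> \<open>(C2) quantifies over all \<open>u\<close>. As edges stay inside the vertex
      set, the local condition is available at \<open>u\<close>, where \<open>v\<close> and
      \<open>w\<close> would be two neighbours of value -1.\<close>
    then have "u \<in> verts G"
      using G by (auto simp: fin_simple_graph_def adjacent_def)
    then obtain us where us: "distinct us" "{x. adjacent G x u} = set us"
      and "locally_PLSRD (f u) (map f us)"
      using nbrs by blast
    then have "card {x \<in> set us. f x = -1} \<le> 1"
      using u by (simp add: locally_PLSRD_def filter_map o_def length_filter_eq_card)
    moreover have "card {v, w} \<le> card {x \<in> set us. f x = -1}"
      using us u vw by (intro card_mono) auto
    ultimately show False
      using vw by simp
  qed
next
  fix v assume v: "v \<in> verts G"
  then obtain us where us: "distinct us" "{u. adjacent G u v} = set us"
    and loc: "locally_PLSRD (f v) (map f us)"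
    using nbrs by blast
  \<comment> \<open>Absence of loops keeps \<open>f v\<close> from being counted twice in the sum
    over the closed neighbourhood.\<close>
  have "\<not> adjacent G v v"
    using G by (auto simp: fin_simple_graph_def adjacent_def)
  then have "v \<notin> set us"
    using us by blast
  then have "(\<Sum>u\<in>closed_nbhd G v. f u) = f v + sum_list (map f us)"
    using us by (simp add: closed_nbhd_def sum_list_distinct_conv_sum_set)
  with loc show "(\<Sum>u\<in>closed_nbhd G v. f u) \<ge> 1"
    by (simp add: locally_PLSRD_def)
qed

section \<open>Neighbourhoods in the flower snark\<close>

lemma verts_flower_snark:
  "verts (flower_snark n) = (\<Union>i\<in>{..2 * n}. {va i, vb i, vc i, vd i})"
  by (auto simp: verts_def flower_snark_def)

text \<open>The order of the entries, here and in the next three lemmas, is the one used in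
  \<open>column_ok\<close>, so mapping the labels over the list gives literally the list tested
  there.\<close>

lemma nbrs_va:
  assumes "i \<le> 2 * n"
  shows "{u. adjacent (flower_snark n) u (va i)} =
    set [vb i, va (if i = 0 then 2 * n else i - 1), va (if i = 2 * n then 0 else Suc i)]"
proof -
  have "adjacent (flower_snark n) u (va i) \<longleftrightarrow>
    u \<in> set [vb i, va (if i = 0 then 2 * n else i - 1), va (if i = 2 * n then 0 else Suc i)]" for u
    using assms by (cases u)
      (auto simp: adjacent_def edges_def flower_snark_def doubleton_eq_iff)
  then show ?thesis by blast
qed

lemma nbrs_vb:
  assumes "i \<le> 2 * n"
  shows "{u. adjacent (flower_snark n) u (vb i)} = set [va i, vc i, vd i]"
proof -
  have "adjacent (flower_snark n) u (vb i) \<longleftrightarrow> u \<in> set [va i, vc i, vd i]" for u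
    using assms by (cases u)
      (auto simp: adjacent_def edges_def flower_snark_def doubleton_eq_iff)
  then show ?thesis by blast
qed

lemma nbrs_vc:
  assumes "i \<le> 2 * n"
  shows "{u. adjacent (flower_snark n) u (vc i)} =
    set [vb i, if i = 0 then vd (2 * n) else vc (i - 1), if i = 2 * n then vd 0 else vc (Suc i)]"
proof -
  have "adjacent (flower_snark n) u (vc i) \<longleftrightarrow>
    u \<in> set [vb i, if i = 0 then vd (2 * n) else vc (i - 1), if i = 2 * n then vd 0 else vc (Suc i)]"
    for u
    using assms by (cases u)
      (auto simp: adjacent_def edges_def flower_snark_def doubleton_eq_iff)
  then show ?thesis by blast
qed

lemma nbrs_vd:
  assumes "i \<le> 2 * n"
  shows "{u. adjacent (flower_snark n) u (vd i)} =
    set [vb i, if i = 0 then vc (2 * n) else vd (i - 1), if i = 2 * n then vc 0 else vd (Suc i)]"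
proof -
  have "adjacent (flower_snark n) u (vd i) \<longleftrightarrow>
    u \<in> set [vb i, if i = 0 then vc (2 * n) else vd (i - 1), if i = 2 * n then vc 0 else vd (Suc i)]"
    for u
    using assms by (cases u)
      (auto simp: adjacent_def edges_def flower_snark_def doubleton_eq_iff)
  then show ?thesis by blast
qed

section \<open>Labellings as sequences of columns\<close>

type_synonym column = "int \<times> int \<times> int \<times> int"

text \<open>From either end of the crossing edges between stars 2n and 0, the other star appears
  with c and d exchanged; being an involution, one map serves both directions.\<close>

fun twist :: "column \<Rightarrow> column" where
  "twist (a, b, c, d) = (a, b, d, c)"

fun column_sum :: "column \<Rightarrow> int" where
  "column_sum (a, b, c, d) = a + b + c + d"

fun column_ok :: "column \<Rightarrow> column \<Rightarrow> column \<Rightarrow> bool" where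
  "column_ok (a, b, c, d) (a', b', c', d') (a'', b'', c'', d'') \<longleftrightarrow>
     locally_PLSRD a' [b', a, a''] \<and> locally_PLSRD b' [a', c', d'] \<and>
     locally_PLSRD c' [b', c, c''] \<and> locally_PLSRD d' [b', d, d'']"

fun label :: "(nat \<Rightarrow> column) \<Rightarrow> snark_vertex \<Rightarrow> int" where
  "label X (va i) = (case X i of (a, b, c, d) \<Rightarrow> a)"
| "label X (vb i) = (case X i of (a, b, c, d) \<Rightarrow> b)"
| "label X (vc i) = (case X i of (a, b, c, d) \<Rightarrow> c)"
| "label X (vd i) = (case X i of (a, b, c, d) \<Rightarrow> d)"

lemma PLSRD_label:
  assumes n: "n \<ge> 1"
    and ok: "\<And>i. i \<le> 2 * n \<Longrightarrow>
      column_ok (if i = 0 then twist (X (2 * n)) else X (i - 1)) (X i)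
        (if i = 2 * n then twist (X 0) else X (Suc i))"
  shows "PLSRD (flower_snark n) (label X)"
proof (rule PLSRD_if_locally_PLSRD)
  show "fin_simple_graph (flower_snark n)"
    using n by (rule fin_simple_graph_flower_snark)
next
  fix v assume "v \<in> verts (flower_snark n)"
  then obtain i where i: "i \<le> 2 * n" and v: "v \<in> {va i, vb i, vc i, vd i}"
    by (auto simp: verts_flower_snark)
  note ok = ok[OF i]
  \<comment> \<open>These are all columns that can occur at or next to position \<open>i\<close>.
    For \<open>i = 0\<close> the truncated \<open>i - 1\<close> is harmless, since the conditional
    then selects the twisted last column.\<close>
  obtain a b c d a' b' c' d' a'' b'' c'' d'' a\<^sub>0 b\<^sub>0 c\<^sub>0 d\<^sub>0 a\<^sub>1 b\<^sub>1 c\<^sub>1 d\<^sub>1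
    where X: "X i = (a, b, c, d)" "X (i - 1) = (a', b', c', d')" "X (Suc i) = (a'', b'', c'', d'')"
      "X 0 = (a\<^sub>0, b\<^sub>0, c\<^sub>0, d\<^sub>0)" "X (2 * n) = (a\<^sub>1, b\<^sub>1, c\<^sub>1, d\<^sub>1)"
    by (metis prod_cases4)
  from v consider "v = va i" | "v = vb i" | "v = vc i" | "v = vd i"
    by blast
  then show "\<exists>us. distinct us \<and> {u. adjacent (flower_snark n) u v} = set us \<and>
    locally_PLSRD (label X v) (map (label X) us)"
  proof cases
    case 1
    show ?thesis
      unfolding 1 nbrs_va[OF i]
      \<comment> \<open>Distinctness is postponed so that \<open>refl\<close> first instantiates
        \<open>us\<close> with the list of neighbours; it then holds because there are at least
        three stars.\<close>
      by (rule exI, rule conjI[rotated], rule conjI, rule refl)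
        (use ok n X in \<open>auto split: if_splits\<close>)
  next
    case 2
    show ?thesis
      unfolding 2 nbrs_vb[OF i]
      by (rule exI, rule conjI[rotated], rule conjI, rule refl)
        (use ok n X in \<open>auto split: if_splits\<close>)
  next
    case 3
    show ?thesis
      unfolding 3 nbrs_vc[OF i]
      by (rule exI, rule conjI[rotated], rule conjI, rule refl)
        (use ok n X in \<open>auto split: if_splits\<close>)
  next
    case 4
    show ?thesis
      unfolding 4 nbrs_vd[OF i]
      by (rule exI, rule conjI[rotated], rule conjI, rule refl)
        (use ok n X in \<open>auto split: if_splits\<close>)
  qed
qed

lemma weight_label:
  "weight (flower_snark n) (label X) = (\<Sum>i\<le>2 * n. column_sum (X i))"
proof -
  have "weight (flower_snark n) (label X) =
    (\<Sum>i\<le>2 * n. \<Sum>v\<in>{va i, vb i, vc i, vd i}. label X v)"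
    unfolding weight_def verts_flower_snark by (rule sum.UNION_disjoint) auto
  also have "\<dots> = (\<Sum>i\<le>2 * n. column_sum (X i))"
    by (rule sum.cong) (auto split: prod.splits)
  finally show ?thesis .
qed

section \<open>The explicit labelling\<close>

definition block :: "column list" where
  "block = [(2, 1, -1, 2), (-1, 1, 2, -1), (-1, 1, 2, -1), (2, 1, -1, 2)]"

definition tail :: "nat \<Rightarrow> column list" where
  "tail n = (if even n then [(2, -1, 1, 1)] else [(1, -1, 1, 2), (-1, -1, 2, 1), (2, 2, 1, -1)])"

text \<open>With k = \<open>n div 2\<close>, the k blocks leave 2n + 1 - 4k positions for the tail:
  one for even n, three for odd n.\<close>

definition columns :: "nat \<Rightarrow> nat \<Rightarrow> column" where
  "columns n i = (if i < 4 * (n div 2) then block ! (i mod 4) else tail n ! (i - 4 * (n div 2)))"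

text \<open>Nested \<open>Suc\<close> matches the successor positions that \<open>column_ok\<close>
  is applied to.\<close>

lemma columns_block:
  assumes "j < n div 2"
  shows "columns n (4 * j) = (2, 1, -1, 2)"
    and "columns n (Suc (4 * j)) = (-1, 1, 2, -1)"
    and "columns n (Suc (Suc (4 * j))) = (-1, 1, 2, -1)"
    and "columns n (Suc (Suc (Suc (4 * j)))) = (2, 1, -1, 2)"
proof -
  have "(4 * j) mod 4 = 0" "Suc (4 * j) mod 4 = 1" "Suc (Suc (4 * j)) mod 4 = 2"
    "Suc (Suc (Suc (4 * j))) mod 4 = 3"
    by presburger+
  moreover have "Suc (Suc (Suc (4 * j))) < 4 * (n div 2)"
    using assms by simp
  ultimately show "columns n (4 * j) = (2, 1, -1, 2)"
    and "columns n (Suc (4 * j)) = (-1, 1, 2, -1)"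
    and "columns n (Suc (Suc (4 * j))) = (-1, 1, 2, -1)"
    and "columns n (Suc (Suc (Suc (4 * j)))) = (2, 1, -1, 2)"
    by (simp_all add: columns_def block_def)
qed

lemma column_ok_columns:
  assumes n: "n \<ge> 2" and i: "i \<le> 2 * n"
  shows "column_ok (if i = 0 then twist (columns n (2 * n)) else columns n (i - 1)) (columns n i)
    (if i = 2 * n then twist (columns n 0) else columns n (Suc i))"
proof -
  define k where "k = n div 2"
  have k: "k > 0" and nk: "n = (if even n then 2 * k else Suc (2 * k))"
    using n by (auto simp: k_def)
  note block = columns_block[of _ n, folded k_def]
  \<comment> \<open>For even n the tail has one entry, so only the first equation is informative;
    the other two serve odd n.\<close>
  have tail: "columns n (4 * k) = tail n ! 0" "columns n (Suc (4 * k)) = tail n ! 1"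
    "columns n (Suc (Suc (4 * k))) = tail n ! 2"
    by (simp_all add: columns_def k_def)
  have last: "columns n (2 * n) = (if even n then (2, -1, 1, 1) else (2, 2, 1, -1))"
    using nk tail by (auto simp: tail_def split: if_splits)
  have first: "columns n 0 = (2, 1, -1, 2)"
    using block(1)[OF k] by simp
  have before: "columns n (4 * j - 1) = (2, 1, -1, 2)" if "0 < j" "j \<le> k" for j
    using block(4)[of "j - 1"] that by (cases j) (simp_all add: numeral_3_eq_3)
  note simps = locally_PLSRD_def tail_def
  show ?thesis
  proof (cases "i < 4 * k")
    case True
    define j where "j = i div 4"
    have j: "j < k"
      using True by (simp add: j_def)
    have Suc4: "Suc (Suc (Suc (Suc (4 * j)))) = 4 * Suc j"
      by simp
    have "i = 4 * j \<or> i = Suc (4 * j) \<or> i = Suc (Suc (4 * j)) \<or> i = Suc (Suc (Suc (4 * j)))"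
      unfolding j_def by presburger
    moreover have "i \<noteq> 2 * n"
      using True nk by (auto split: if_splits)
    \<comment> \<open>Only the outer columns of a block have a neighbour outside it: to the left the
      previous block or, across the exchange, the end of the tail; to the right the next block or
      the start of the tail.\<close>
    moreover have "column_ok (if j = 0 then twist (columns n (2 * n)) else columns n (4 * j - 1))
      (columns n (4 * j)) (columns n (Suc (4 * j)))"
      using last before[of j] block(1,2)[OF j] j by (simp add: simps)
    moreover have "column_ok (columns n (Suc (Suc (4 * j)))) (columns n (Suc (Suc (Suc (4 * j)))))
      (columns n (Suc (Suc (Suc (Suc (4 * j))))))"
    proof (cases "Suc j < k")
      case True
      show ?thesis
        unfolding Suc4 using block(3,4)[OF j] block(1)[OF True] by (simp add: simps)
    next
      case False
      then have Suc_j: "Suc j = k"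
        using j by simp
      show ?thesis
        unfolding Suc4 Suc_j tail using block(3,4)[OF j] by (simp add: simps)
    qed
    ultimately show ?thesis
      using block[OF j] by (auto simp: simps)
  next
    case False
    then consider "even n" "i = 4 * k" | "odd n" "i = 4 * k" | "odd n" "i = Suc (4 * k)"
      | "odd n" "i = Suc (Suc (4 * k))"
      using i nk by (auto split: if_splits) linarith
    then show ?thesis
    proof cases
      case 1
      \<comment> \<open>Here the exchange matters: the c-entry 1 has -1 at its b-neighbour and to
        its left, and only the twisted first column supplies the 2 that lifts its sum to 1.\<close>
      then have "i = 2 * n" using nk by simp
      then show ?thesis
        using 1 k tail first before[of k] by (simp add: simps)
    next
      case 2
      then have "i \<noteq> 2 * n" using nk by simp
      then show ?thesis
        using 2 k tail before[of k] by (simp add: simps)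
    next
      case 3
      then have "i \<noteq> 2 * n" using nk by simp
      then show ?thesis
        using 3 tail by (simp add: simps)
    next
      case 4
      then have "2 * n = Suc (Suc (4 * k))" using nk by simp
      then show ?thesis
        using 4 tail first by (simp add: simps)
    qed
  qed
qed

section \<open>The weight of the labelling\<close>

lemma sum_column_sum_block:
  "(\<Sum>i<4 * k. column_sum (block ! (i mod 4))) = 10 * int k"
proof (induction k)
  case (Suc k)
  have *: "4 * Suc k = Suc (Suc (Suc (Suc (4 * k))))"
    by simp
  have "(4 * k) mod 4 = 0" "Suc (4 * k) mod 4 = 1" "Suc (Suc (4 * k)) mod 4 = 2"
    "Suc (Suc (Suc (4 * k))) mod 4 = 3"
    by presburger+
  then show ?case
    unfolding * using Suc by (simp add: block_def)
qed simp

text \<open>Both parities give the same formula: 10k + 3 with n = 2k, and 10k + 8 with n = 2k + 1.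
  For odd n this is one below the bound to be shown.\<close>

lemma sum_column_sum_columns:
  "(\<Sum>i\<le>2 * n. column_sum (columns n i)) = 5 * int n + 3"
proof -
  define k where "k = n div 2"
  have *: "(\<Sum>i<4 * k. column_sum (columns n i)) = 10 * int k"
    using sum_column_sum_block[of k] by (simp add: columns_def k_def)
  show ?thesis
  proof (cases "even n")
    case True
    then have "{..2 * n} = insert (4 * k) {..<4 * k}" "n = 2 * k"
      by (auto simp: k_def)
    with * True show ?thesis
      by (simp add: columns_def tail_def)
  next
    case False
    then have "{..2 * n} = insert (4 * k + 2) (insert (4 * k + 1) (insert (4 * k) {..<4 * k}))"
      "n = 2 * k + 1"
      by (auto simp: k_def elim: oddE)
    with * False show ?thesis
      by (simp add: columns_def tail_def)
  qed
qed

theorem theorem6: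
  fixes n :: nat
  assumes "n \<ge> 2"
  shows "plsR_number (flower_snark n) \<le> (if even n then 5 * int n + 3 else 5 * int n + 4)"
proof -
  have "plsR_number (flower_snark n) \<le> weight (flower_snark n) (label (columns n))"
    using assms
    by (intro plsR_number_le_weight fin_simple_graph_flower_snark PLSRD_label column_ok_columns)
      auto
  then show ?thesis
    by (simp add: weight_label sum_column_sum_columns)
qed

end
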